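(* Let $n\ge 4$ be an integer and let $F$ be a field of characteristic zero. Suppose $f:N_n(F)\rightarrow N_n(F)$ is an $F$-linear map satisfying $[f(X),X^2]=0$ for all $X\in N_n(F)$. Then there exist $\lambda\in F$ and an additive map $\mu:N_n(F)\rightarrow \Psi$ such that $f(X)=\lambda X+\mu(X)$ for every $X\in N_n(F)$, where $\Psi=\{a_1e_{1,n-1}+a_2e_{1,n}+a_3e_{2,n-1}+a_4e_{2,n}:a_1,a_2,a_3,a_4\in F\}$.
   Context: $N_n(F)$ denotes the (non-unital) ring of $n\times n$ strictly upper triangular matrices with entries in $F$. $[A,B]=AB-BA$ is the ring commutator. $e_{i,j}$ denotes the standard matrix unit with a $1$ in position $(i,j)$ and all other entries $0$. *)

theory Defs
  imports "Jordan_Normal_Form.Matrix"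
begin

definition strict_upper_mats :: "nat \<Rightarrow> 'a::zero mat set" where
  "strict_upper_mats n =
     {A \<in> carrier_mat n n. \<forall>i < n. \<forall>j \<le> i. A $$ (i, j) = 0}"

definition mat_commutator :: "'a::ring mat \<Rightarrow> 'a mat \<Rightarrow> 'a mat" where
  "mat_commutator A B = A * B - B * A"

text \<open>Row and column numbers of a matrix unit start at 1, as on paper,
  whereas the entries of a matrix are indexed from 0.\<close>

definition matrix_unit :: "nat \<Rightarrow> nat \<Rightarrow> nat \<Rightarrow> 'a::zero_neq_one mat" where
  "matrix_unit n i j = mat n n (\<lambda>(r, c). if r + 1 = i \<and> c + 1 = j then 1 else 0)"

definition additive_map_on :: "'a::plus mat set \<Rightarrow> ('a mat \<Rightarrow> 'a mat) \<Rightarrow> bool" where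
  "additive_map_on S f \<longleftrightarrow> (\<forall>X \<in> S. \<forall>Y \<in> S. f (X + Y) = f X + f Y)"

definition linear_map_on :: "'a::semiring_0 mat set \<Rightarrow> ('a mat \<Rightarrow> 'a mat) \<Rightarrow> bool" where
  "linear_map_on S f \<longleftrightarrow>
     additive_map_on S f \<and> (\<forall>c. \<forall>X \<in> S. f (c \<cdot>\<^sub>m X) = c \<cdot>\<^sub>m f X)"

definition Psi :: "nat \<Rightarrow> 'a::field mat set" where
  "Psi n =
     {a1 \<cdot>\<^sub>m matrix_unit n 1 (n - 1) + a2 \<cdot>\<^sub>m matrix_unit n 1 n
      + a3 \<cdot>\<^sub>m matrix_unit n 2 (n - 1) + a4 \<cdot>\<^sub>m matrix_unit n 2 n | a1 a2 a3 a4 :: 'a. True}"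

end

theory Submission
  imports Defs
begin

text \<open>In characteristic zero the identity $[f(X),X^2]=0$ is equivalent to its polarization: the
  sum of $[f(X),YZ]$ over all permutations of the three arguments vanishes. Evaluated on matrix
  units, with two arguments $e_{p,q}$ and $e_{q,r}$ whose product is $e_{p,r}$ and the third one
  chosen so that most other products vanish, it says that column $p$ and row $r$ of
  $f(e_{i,j})$ agree with those of $\lambda e_{i,j}$. This reaches every column with
  $p \le n-2$ and every row with $r \ge 3$, and the positions left over are those of $\Psi$.\<close>

text \<open>With \<open>G i j a b\<close> the entry \<open>(a, b)\<close> of $f(e_{i,j})$, this is the entry \<open>(a, b)\<close> of
  $[f(e_{i,j}), e_{p,q} e_{s,r}]$; here all indices start at 0.\<close>

definition commutator_coeff ::
    "(nat \<Rightarrow> nat \<Rightarrow> nat \<Rightarrow> nat \<Rightarrow> 'a::ring_1) \<Rightarrow> nat \<Rightarrow> nat \<Rightarrow> nat \<Rightarrow> nat \<Rightarrow> nat \<Rightarrow> nat \<Rightarrow> nat \<Rightarrow> nat \<Rightarrow> 'a" where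
  "commutator_coeff G i j p q s r a b =
    (if q = s then (if b = r then G i j a p else 0) - (if a = p then G i j r b else 0) else 0)"

section \<open>Entries of \<open>f\<close> on matrix units, all indices starting at 0\<close>

locale coefficient_identity =
  fixes n :: nat and G :: "nat \<Rightarrow> nat \<Rightarrow> nat \<Rightarrow> nat \<Rightarrow> 'a::field_char_0"
  assumes upper: "\<lbrakk>i < j; j < n; b \<le> a; a < n\<rbrakk> \<Longrightarrow> G i j a b = 0"
    and polarized: "\<lbrakk>i < j; j < n; p < q; q < n; s < r; r < n; a < n; b < n\<rbrakk> \<Longrightarrow>
      commutator_coeff G i j p q s r a b + commutator_coeff G i j s r p q a b + commutator_coeff G p q i j s r a b
      + commutator_coeff G p q s r i j a b + commutator_coeff G s r i j p q a b + commutator_coeff G s r p q i j a b = 0"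
begin

text \<open>The arguments e_{i,j}, e_{i,j}, e_{j,l} leave only 2[f(e_{i,j}), e_{i,l}] = 0, and 2
  cancels in characteristic zero. In column \<open>l\<close> and in row \<open>i\<close> of this
  commutator \<open>upper\<close> removes one of the two summands.\<close>

lemma right_mult:
  assumes "i < j" "j < l" "l < n" "a < n"
  shows "G i j a i = 0" and "G i j l a = 0"
proof -
  show "G i j a i = 0"
    using polarized[of i j i j j l a l] upper[of i j l l] assms by (simp add: commutator_coeff_def split: if_splits)
  show "G i j l a = 0"
    using polarized[of i j i j j l i a] upper[of i j i i] assms by (simp add: commutator_coeff_def split: if_splits)
qed

text \<open>Mirror image of \<open>right_mult\<close> under reflection in the antidiagonal: e_{k,i}
  now multiplies e_{i,j} from the left.\<close>

lemma left_mult: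
  assumes "k < i" "i < j" "j < n" "a < n"
  shows "G i j a k = 0" and "G i j j a = 0"
proof -
  show "G i j a k = 0"
    using polarized[of i j i j k i a j] upper[of i j j j] assms by (simp add: commutator_coeff_def split: if_splits)
  show "G i j j a = 0"
    using polarized[of i j i j k i k a] upper[of i j k k] assms by (simp add: commutator_coeff_def split: if_splits)
qed

text \<open>The four inequalities say exactly that e_{i,j} has zero product, on either side, with
  e_{p,q} and e_{q,r}. Only [f(e_{i,j}), e_{p,r}] = 0 survives.\<close>

lemma orthogonal:
  assumes "i < j" "j < n" "p < q" "q < r" "r < n" "q \<noteq> i" "q \<noteq> j" "p \<noteq> j" "r \<noteq> i" "a < n"
  shows "G i j a p = 0" and "G i j r a = 0"
proof -
  show "G i j a p = 0"
    using polarized[of i j p q q r a r] upper[of i j r r] assms by (simp add: commutator_coeff_def split: if_splits)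
  show "G i j r a = 0"
    using polarized[of i j p q q r p a] upper[of i j p p] assms by (simp add: commutator_coeff_def split: if_splits)
qed

text \<open>The arguments e_{i,j}, e_{j,q}, e_{q,r} give [f(e_{i,j}), e_{j,r}] +
  [f(e_{q,r}), e_{i,q}] = 0. This couples the values of \<open>f\<close> at two different units and
  is the source of the common scalar.\<close>

lemma chain:
  assumes "i < j" "j < q" "q < r" "r < n" "a < n"
  shows "G i j a j = (if a = i then G q r q r else 0)"
    and "G q r q a = (if a = r then G i j i j else 0)"
proof -
  show "G i j a j = (if a = i then G q r q r else 0)"
    using polarized[of i j j q q r a r] upper[of i j r r] upper[of i j j j] assms
    by (simp add: commutator_coeff_def split: if_splits)
  show "G q r q a = (if a = r then G i j i j else 0)"
    using polarized[of i j j q q r i a] upper[of q r i i] upper[of q r q q] assms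
    by (simp add: commutator_coeff_def split: if_splits)
qed

text \<open>Since e_{i,q} and e_{p,q} both multiply e_{q,r}, the identity reads
  [f(e_{i,q}), e_{p,r}] + [f(e_{p,q}), e_{i,r}] = 0; \<open>left_mult\<close> kills the contribution
  of the second commutator.\<close>

lemma common_column:
  assumes "i < p" "p < q" "q < r" "r < n" "a < n"
  shows "G i q a p = 0"
  using polarized[of i q p q q r a r] upper[of i q r r] upper[of p q r r]
    left_mult(1)[of i p q a] assms by (simp add: commutator_coeff_def split: if_splits)

text \<open>Mirror image of \<open>common_column\<close>: e_{q,j} and e_{q,r} are both multiplied by
  e_{p,q} from the left.\<close>

lemma common_row:
  assumes "p < q" "q < r" "r < j" "j < n" "a < n"
  shows "G q j r a = 0"
  using polarized[of q j p q q r p a] upper[of q j p p] upper[of q r p p]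
    right_mult(2)[of q r j a] assms by (simp add: commutator_coeff_def split: if_splits)

text \<open>\<open>chain\<close> compares e_{i,j} with e_{q,r} only when \<open>j < q\<close>, so
  each unit is compared with the last or the first unit of the superdiagonal; the side condition
  leaves room for one of them.\<close>

lemma diagonal:
  assumes "n \<ge> 4" "i < j" "j < n" "j + 2 < n \<or> 2 \<le> i"
  shows "G i j i j = G 0 1 0 1"
proof -
  \<comment> \<open>Here \<open>n \<ge> 4\<close> enters: \<open>chain\<close> needs 1 < n -
    2.\<close>
  have ends: "G (n-2) (n-1) (n-2) (n-1) = G 0 1 0 1"
    using chain(1)[of 0 1 "n-2" "n-1" 0] assms by simp
  show ?thesis
    using assms(4)
  proof
    assume "j + 2 < n"
    then show ?thesis using chain(1)[of i j "n-2" "n-1" i] ends assms by simp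
  next
    assume "2 \<le> i"
    then show ?thesis using chain(1)[of 0 1 i j 0] assms by simp
  qed
qed

lemma column:
  assumes "n \<ge> 4" "i < j" "j < n" "p + 2 < n" "a < n"
  shows "G i j a p = (if a = i \<and> p = j then G 0 1 0 1 else 0)"
proof -
  \<comment> \<open>The last case is the one out of reach of \<open>orthogonal\<close>: the only
    index strictly between p = n - 3 and n - 1 is n - 2 = j. There \<open>right_mult\<close> serves
    for i = p and \<open>common_column\<close> for i < p.\<close>
  consider "p < i" | "p = j" | "i \<le> p" "p \<noteq> j" "p + 3 < n \<or> j \<noteq> n - 2"
    | "i \<le> p" "p + 3 = n" "j = n - 2"
    using assms by linarith
  then show ?thesis
  proof cases
    case 1
    then show ?thesis using left_mult(1)[of p i j a] assms by simp
  next
    case 2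
    then show ?thesis
      using chain(1)[of i j "n-2" "n-1" a] diagonal[of i j] diagonal[of "n-2" "n-1"] assms by simp
  next
    case 3
    \<comment> \<open>An index strictly between p and n - 1 that avoids j; it avoids i because
      \<open>i \<le> p\<close>.\<close>
    define q where "q = (if j = p + 1 then p + 2 else p + 1)"
    have "p < q" "q < n - 1" "q \<noteq> i" "q \<noteq> j"
      using 3 assms by (auto simp: q_def)
    then show ?thesis using orthogonal(1)[of i j p q "n-1" a] 3 assms by simp
  next
    case 4
    then show ?thesis
      using right_mult(1)[of i j "n-1" a] common_column[of i p j "n-1" a] assms
      by (cases "i = p") auto
  qed
qed

text \<open>Mirror image of \<open>column\<close>, with e_{0,1} in place of the last superdiagonal
  unit.\<close>

lemma row:
  assumes "n \<ge> 4" "i < j" "j < n" "2 \<le> r" "r < n" "a < n"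
  shows "G i j r a = (if r = i \<and> a = j then G 0 1 0 1 else 0)"
proof -
  consider "j < r" | "r = i" | "r \<le> j" "r \<noteq> i" "3 \<le> r \<or> i \<noteq> 1"
    | "r \<le> j" "r = 2" "i = 1"
    using assms by linarith
  then show ?thesis
  proof cases
    case 1
    then show ?thesis using right_mult(2)[of i j r a] assms by simp
  next
    case 2
    then show ?thesis
      using chain(2)[of 0 1 i j a] assms by simp
  next
    case 3
    \<comment> \<open>An index strictly between 0 and r that avoids i; it avoids j because
      \<open>r \<le> j\<close>. For i = 1 and r = 2 there is none, hence the fourth case.\<close>
    define q where "q = (if i = r - 1 then r - 2 else r - 1)"
    have "0 < q" "q < r" "q \<noteq> i" "q \<noteq> j"
      using 3 assms by (auto simp: q_def)
    then show ?thesis using orthogonal(2)[of i j 0 q r a] 3 assms by simp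
  next
    case 4
    then show ?thesis
      using left_mult(2)[of 0 i j a] common_row[of 0 i r j a] assms
      by (cases "r = j") auto
  qed
qed

end

section \<open>Matrix units and their commutators\<close>

lemma strict_upper_mats_carrier: "X \<in> strict_upper_mats n \<Longrightarrow> X \<in> carrier_mat n n"
  by (simp add: strict_upper_mats_def)

lemma matrix_unit_carrier [simp]: "matrix_unit n i j \<in> carrier_mat n n"
  by (simp add: matrix_unit_def)

lemma matrix_unit_strict_upper: "i < j \<Longrightarrow> matrix_unit n i j \<in> strict_upper_mats n"
  by (auto simp: strict_upper_mats_def matrix_unit_def)

lemma strict_upper_mats_add:
  fixes X Y :: "'a::monoid_add mat"
  shows "X \<in> strict_upper_mats n \<Longrightarrow> Y \<in> strict_upper_mats n \<Longrightarrow> X + Y \<in> strict_upper_mats n"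
  by (auto simp: strict_upper_mats_def)

lemma strict_upper_mats_smult:
  fixes X :: "'a::mult_zero mat"
  shows "X \<in> strict_upper_mats n \<Longrightarrow> c \<cdot>\<^sub>m X \<in> strict_upper_mats n"
  by (auto simp: strict_upper_mats_def)

lemma mult_matrix_unit_index:
  fixes A :: "'a::semiring_1 mat"
  assumes "A \<in> carrier_mat n n" "p < n" "r < n" "a < n" "b < n"
  shows "(A * matrix_unit n (Suc p) (Suc r)) $$ (a, b) = (if b = r then A $$ (a, p) else 0)"
  using assms
  by (cases "b = r") (auto simp: matrix_unit_def scalar_prod_def atLeast0LessThan if_distrib[of "(*) _"] cong: if_cong)

lemma matrix_unit_mult_index:
  fixes A :: "'a::semiring_1 mat"
  assumes "A \<in> carrier_mat n n" "p < n" "r < n" "a < n" "b < n"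
  shows "(matrix_unit n (Suc p) (Suc r) * A) $$ (a, b) = (if a = p then A $$ (r, b) else 0)"
  using assms
  by (cases "a = p") (auto simp: matrix_unit_def scalar_prod_def atLeast0LessThan if_distrib[of "\<lambda>x. x * _"] cong: if_cong)

lemma matrix_unit_mult:
  assumes "p < n" "q < n" "s < n" "r < n"
  shows "matrix_unit n (Suc p) (Suc q) * matrix_unit n (Suc s) (Suc r) =
    (if q = s then matrix_unit n (Suc p) (Suc r) else 0\<^sub>m n n :: 'a::semiring_1 mat)"
proof (rule eq_matI)
  fix a b
  assume "a < dim_row (if q = s then matrix_unit n (Suc p) (Suc r) else 0\<^sub>m n n :: 'a mat)"
    and "b < dim_col (if q = s then matrix_unit n (Suc p) (Suc r) else 0\<^sub>m n n :: 'a mat)"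
  then have "a < n" "b < n" by (auto simp: matrix_unit_def split: if_splits)
  then show "(matrix_unit n (Suc p) (Suc q) * matrix_unit n (Suc s) (Suc r)) $$ (a, b) =
      (if q = s then matrix_unit n (Suc p) (Suc r) else 0\<^sub>m n n :: 'a mat) $$ (a, b)"
    using assms by (subst mult_matrix_unit_index) (auto simp: matrix_unit_def)
qed (auto simp: matrix_unit_def)

lemma commutator_matrix_unit_index:
  fixes A :: "'a::ring_1 mat"
  assumes "A \<in> carrier_mat n n" "p < n" "r < n" "a < n" "b < n"
  shows "mat_commutator A (matrix_unit n (Suc p) (Suc r)) $$ (a, b) =
    (if b = r then A $$ (a, p) else 0) - (if a = p then A $$ (r, b) else 0)"
proof -
  have "mat_commutator A (matrix_unit n (Suc p) (Suc r)) $$ (a, b) =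
      (A * matrix_unit n (Suc p) (Suc r)) $$ (a, b) - (matrix_unit n (Suc p) (Suc r) * A) $$ (a, b)"
    using assms by (simp add: mat_commutator_def matrix_unit_def)
  then show ?thesis
    using assms by (simp only: mult_matrix_unit_index matrix_unit_mult_index)
qed

section \<open>Polarization and reduction to matrix units\<close>

lemma commutator_add_left:
  fixes A B C :: "'a::ring mat"
  assumes "A \<in> carrier_mat n n" "B \<in> carrier_mat n n" "C \<in> carrier_mat n n" "a < n" "b < n"
  shows "mat_commutator (A + B) C $$ (a, b) = mat_commutator A C $$ (a, b) + mat_commutator B C $$ (a, b)"
  using assms by (simp add: mat_commutator_def add_mult_distrib_mat[OF assms(1,2,3)]
      mult_add_distrib_mat[OF assms(3,1,2)] del: index_mult_mat(1))

lemma commutator_add_right: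
  fixes A B C :: "'a::ring mat"
  assumes "A \<in> carrier_mat n n" "B \<in> carrier_mat n n" "C \<in> carrier_mat n n" "a < n" "b < n"
  shows "mat_commutator C (A + B) $$ (a, b) = mat_commutator C A $$ (a, b) + mat_commutator C B $$ (a, b)"
  using assms by (simp add: mat_commutator_def add_mult_distrib_mat[OF assms(1,2,3)]
      mult_add_distrib_mat[OF assms(3,1,2)] del: index_mult_mat(1))

text \<open>Linearizing the cubic identity twice needs no division. Passing to a fixed entry
  \<open>t\<close> makes it an identity between triadditive ring-valued functions.\<close>

lemma polarized_commutator:
  fixes f :: "'a::ring mat \<Rightarrow> 'a mat"
  assumes S: "S \<subseteq> carrier_mat n n" and add_closed: "\<And>X Y. X \<in> S \<Longrightarrow> Y \<in> S \<Longrightarrow> X + Y \<in> S"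
    and f: "f \<in> S \<rightarrow> carrier_mat n n" and add: "additive_map_on S f"
    and comm: "\<And>X. X \<in> S \<Longrightarrow> mat_commutator (f X) (X * X) = 0\<^sub>m n n"
    and mem: "X \<in> S" "Y \<in> S" "Z \<in> S" and ab: "a < n" "b < n"
  defines "t \<equiv> \<lambda>X Y Z. mat_commutator (f X) (Y * Z) $$ (a, b)"
  shows "t X Y Z + t X Z Y + t Y X Z + t Y Z X + t Z X Y + t Z Y X = 0"
proof -
  have fc: "f U \<in> carrier_mat n n" if "U \<in> S" for U using f that by blast
  have carrier: "U \<in> carrier_mat n n" if "U \<in> S" for U using S that by blast
  have t1: "t (U + V) Y Z = t U Y Z + t V Y Z" if "U \<in> S" "V \<in> S" "Y \<in> S" "Z \<in> S" for U V Y Z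
    using add that commutator_add_left[of "f U" n "f V" "Y * Z" a b] carrier[of Y] carrier[of Z] fc ab
    by (simp add: t_def additive_map_on_def)
  have t2: "t Y (U + V) Z = t Y U Z + t Y V Z" if "U \<in> S" "V \<in> S" "Y \<in> S" "Z \<in> S" for U V Y Z
    using that commutator_add_right[of "U * Z" n "V * Z" "f Y" a b] carrier[of Z] fc ab
    by (simp add: t_def add_mult_distrib_mat[OF carrier carrier carrier, of U V Z] carrier mult_carrier_mat[of _ n n])
  have t3: "t Y Z (U + V) = t Y Z U + t Y Z V" if "U \<in> S" "V \<in> S" "Y \<in> S" "Z \<in> S" for U V Y Z
    using that commutator_add_right[of "Z * U" n "Z * V" "f Y" a b] carrier[of Z] fc ab
    by (simp add: t_def mult_add_distrib_mat[OF carrier carrier carrier, of Z U V] carrier mult_carrier_mat[of _ n n])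
  have t0: "t U U U = 0" if "U \<in> S" for U
    using comm[OF that] ab by (simp add: t_def)
  have two: "t U U V + t U V U + t V U U + t U V V + t V U V + t V V U = 0"
    if "U \<in> S" "V \<in> S" for U V
    using t0[of "U + V"] t0[of U] t0[of V] that by (simp add: t1 t2 t3 add_closed algebra_simps)
  let ?two = "\<lambda>U V. t U U V + t U V U + t V U U + t U V V + t V U V + t V V U"
  \<comment> \<open>In \<open>?two U V\<close> three terms are quadratic in U and three are linear.
    The linear ones cancel on the right, and the quadratic ones leave the six mixed terms.\<close>
  have "t X Y Z + t X Z Y + t Y X Z + t Y Z X + t Z X Y + t Z Y X = ?two (X + Y) Z - ?two X Z - ?two Y Z"
    using mem by (simp add: t1 t2 t3 add_closed algebra_simps)
  then show ?thesis using mem by (simp add: two add_closed)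
qed

text \<open>Induction on a finite set \<open>P\<close> of positions containing the support of
  \<open>X\<close>, clearing one entry at a time, replaces the expansion of \<open>X\<close> as a
  sum over matrix units.\<close>

lemma linear_functional_zero:
  fixes L :: "'a::ring_1 mat \<Rightarrow> 'a"
  assumes add: "\<And>X Y. X \<in> strict_upper_mats n \<Longrightarrow> Y \<in> strict_upper_mats n \<Longrightarrow> L (X + Y) = L X + L Y"
    and smult: "\<And>c X. X \<in> strict_upper_mats n \<Longrightarrow> L (c \<cdot>\<^sub>m X) = c * L X"
    and unit: "\<And>i j. i < j \<Longrightarrow> j < n \<Longrightarrow> L (matrix_unit n (Suc i) (Suc j)) = 0"
    and X: "X \<in> strict_upper_mats n"
  shows "L X = 0"
proof -
  have "L X = 0" if "finite P" "X \<in> strict_upper_mats n"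
    "\<And>i j. i < n \<Longrightarrow> j < n \<Longrightarrow> (i, j) \<notin> P \<Longrightarrow> X $$ (i, j) = 0" for P X
    using that
  proof (induction P arbitrary: X)
    case empty
    then have "X = 0 \<cdot>\<^sub>m X" by (auto simp: strict_upper_mats_def intro!: eq_matI)
    then show ?case using smult[OF empty(1), of 0] by simp
  next
    case (insert e P)
    obtain i j where e: "e = (i, j)" by (cases e)
    show ?case
    proof (cases "i < j \<and> j < n")
      case True
      define Y where "Y = mat n n (\<lambda>(k, l). if (k, l) = e then 0 else X $$ (k, l))"
      let ?E = "matrix_unit n (Suc i) (Suc j) :: 'a mat"
      have Y: "Y \<in> strict_upper_mats n"
        using insert.prems(1) by (auto simp: Y_def strict_upper_mats_def)
      have E: "?E \<in> strict_upper_mats n" using True by (simp add: matrix_unit_strict_upper)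
      have "L Y = 0"
        using insert.prems(2) by (intro insert.IH Y) (auto simp: Y_def)
      moreover have "X = Y + (X $$ e) \<cdot>\<^sub>m ?E"
        using insert.prems(1)
        by (auto simp: Y_def e strict_upper_mats_def matrix_unit_def intro!: eq_matI)
      ultimately show ?thesis
        using add[OF Y strict_upper_mats_smult[OF E]] smult[OF E] unit[of i j] True
        by (metis add.right_neutral mult_zero_right)
    next
      case False
      \<comment> \<open>A position that is not strictly upper either carries a zero already or lies
        outside the matrix, so \<open>P\<close> still covers the support.\<close>
      then have "X $$ (k, l) = 0" if "k < n" "l < n" "(k, l) \<notin> P" for k l
        using insert.prems that by (cases "(k, l) = e") (auto simp: e strict_upper_mats_def)
      then show ?thesis using insert.IH insert.prems(1) by blast
    qed
  qed
  from this[of "{..<n} \<times> {..<n}" X] X show ?thesis by simp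
qed

text \<open>Counted from 0, the positions of \<open>Psi\<close> are rows 0, 1 and columns n - 2, n -
  1: the complement of the positions in the last hypothesis.\<close>

lemma Psi_memI:
  fixes A :: "'a::field mat"
  assumes "n \<ge> 4" "A \<in> carrier_mat n n"
    and "\<And>a b. a < n \<Longrightarrow> b < n \<Longrightarrow> b + 2 < n \<or> 2 \<le> a \<Longrightarrow> A $$ (a, b) = 0"
  shows "A \<in> Psi n"
proof -
  have "A = A $$ (0, n - 2) \<cdot>\<^sub>m matrix_unit n 1 (n - 1) + A $$ (0, n - 1) \<cdot>\<^sub>m matrix_unit n 1 n
      + A $$ (1, n - 2) \<cdot>\<^sub>m matrix_unit n 2 (n - 1) + A $$ (1, n - 1) \<cdot>\<^sub>m matrix_unit n 2 n"
    (is "A = ?B")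
  proof (rule eq_matI)
    fix a b assume "a < dim_row ?B" "b < dim_col ?B"
    then have ab: "a < n" "b < n" by (auto simp: matrix_unit_def)
    then consider "b + 2 < n \<or> 2 \<le> a" | "a = 0" "b = n - 2" | "a = 0" "b = n - 1"
      | "a = 1" "b = n - 2" | "a = 1" "b = n - 1" by linarith
    then show "A $$ (a, b) = ?B $$ (a, b)"
      by cases (use assms ab in \<open>auto simp: matrix_unit_def\<close>)
  qed (use assms in \<open>auto simp: matrix_unit_def\<close>)
  then show ?thesis unfolding Psi_def by blast
qed

theorem theorem1p2:
  fixes n :: nat
    and f :: "'a::field_char_0 mat \<Rightarrow> 'a mat"
  assumes "n \<ge> 4"
    and "f \<in> strict_upper_mats n \<rightarrow> strict_upper_mats n"
    and "linear_map_on (strict_upper_mats n) f"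
    and "\<And>X. X \<in> strict_upper_mats n \<Longrightarrow>
           mat_commutator (f X) (X ^\<^sub>m 2) = 0\<^sub>m n n"
  shows "\<exists>(c::'a) (\<mu> :: 'a mat \<Rightarrow> 'a mat).
           \<mu> \<in> strict_upper_mats n \<rightarrow> Psi n \<and>
           additive_map_on (strict_upper_mats n) \<mu> \<and>
           (\<forall>X \<in> strict_upper_mats n. f X = c \<cdot>\<^sub>m X + \<mu> X)"
proof -
  let ?S = "strict_upper_mats n :: 'a mat set"
  let ?E = "\<lambda>i j. matrix_unit n (Suc i) (Suc j) :: 'a mat"
  define G where "G i j a b = f (?E i j) $$ (a, b)" for i j a b
  have fS: "f X \<in> ?S" if "X \<in> ?S" for X using assms(2) that by blast
  have f_add: "f (X + Y) = f X + f Y" if "X \<in> ?S" "Y \<in> ?S" for X Y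
    using assms(3) that by (auto simp: linear_map_on_def additive_map_on_def)
  have f_smult: "f (c \<cdot>\<^sub>m X) = c \<cdot>\<^sub>m f X" if "X \<in> ?S" for c X
    using assms(3) that by (auto simp: linear_map_on_def)
  have dims [simp]: "dim_row X = n" "dim_col X = n" if "X \<in> ?S" for X
    using strict_upper_mats_carrier[OF that] by auto
  have comm: "mat_commutator (f X) (X * X) = 0\<^sub>m n n" if "X \<in> ?S" for X
    using assms(4)[OF that] that by (simp add: numeral_2_eq_2)
  have coeff: "mat_commutator (f (?E i j)) (?E p q * ?E s r) $$ (a, b) = commutator_coeff G i j p q s r a b"
    if "i < j" "j < n" "p < q" "q < n" "s < r" "r < n" "a < n" "b < n" for i j p q s r a b
  proof -
    have "f (?E i j) \<in> carrier_mat n n"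
      using that by (intro strict_upper_mats_carrier fS matrix_unit_strict_upper) auto
    then show ?thesis
      using that by (auto simp: matrix_unit_mult commutator_matrix_unit_index commutator_coeff_def G_def)
        (auto simp: mat_commutator_def)
  qed
  interpret coefficient_identity n G
  proof
    fix i j a b :: nat assume "i < j" "j < n" "b \<le> a" "a < n"
    then show "G i j a b = 0"
      using fS[of "?E i j"] matrix_unit_strict_upper[of "Suc i" "Suc j" n]
      by (auto simp: G_def strict_upper_mats_def)
  next
    fix i j p q s r a b :: nat
    assume *: "i < j" "j < n" "p < q" "q < n" "s < r" "r < n" "a < n" "b < n"
    then have "?E i j \<in> ?S" "?E p q \<in> ?S" "?E s r \<in> ?S"
      by (auto intro: matrix_unit_strict_upper)
    then have "mat_commutator (f (?E i j)) (?E p q * ?E s r) $$ (a, b)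
        + mat_commutator (f (?E i j)) (?E s r * ?E p q) $$ (a, b)
        + mat_commutator (f (?E p q)) (?E i j * ?E s r) $$ (a, b)
        + mat_commutator (f (?E p q)) (?E s r * ?E i j) $$ (a, b)
        + mat_commutator (f (?E s r)) (?E i j * ?E p q) $$ (a, b)
        + mat_commutator (f (?E s r)) (?E p q * ?E i j) $$ (a, b) = 0"
      using * comm fS f_add
      by (intro polarized_commutator[of ?S n])
        (auto simp: strict_upper_mats_add additive_map_on_def intro: strict_upper_mats_carrier)
    then show "commutator_coeff G i j p q s r a b + commutator_coeff G i j s r p q a b
        + commutator_coeff G p q i j s r a b + commutator_coeff G p q s r i j a b
        + commutator_coeff G s r i j p q a b + commutator_coeff G s r p q i j a b = 0"
      using * by (simp only: coeff)
  qed
  \<comment> \<open>The scalar is read off as the coefficient of the first superdiagonal unit in its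
    own image; \<open>column\<close> and \<open>row\<close> refer to the same entry.\<close>
  define c where "c = G 0 1 0 1"
  define \<mu> where "\<mu> X = f X - c \<cdot>\<^sub>m X" for X
  have fX: "f X = c \<cdot>\<^sub>m X + \<mu> X" if "X \<in> ?S" for X
    using that fS[OF that] by (auto simp: \<mu>_def intro!: eq_matI)
  have \<mu>_add: "\<mu> (X + Y) = \<mu> X + \<mu> Y" if "X \<in> ?S" "Y \<in> ?S" for X Y
    using that fS[OF that(1)] fS[OF that(2)]
    by (auto simp: \<mu>_def f_add algebra_simps intro!: eq_matI)
  have \<mu>_smult: "\<mu> (d \<cdot>\<^sub>m X) = d \<cdot>\<^sub>m \<mu> X" if "X \<in> ?S" for d X
    using that fS[OF that] by (auto simp: \<mu>_def f_smult algebra_simps intro!: eq_matI)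
  have \<mu>_carrier: "\<mu> X \<in> carrier_mat n n" if "X \<in> ?S" for X
    using that by (auto simp: \<mu>_def)
  have "\<mu> X \<in> Psi n" if X: "X \<in> ?S" for X
  proof (rule Psi_memI[OF assms(1) \<mu>_carrier[OF X]])
    fix a b assume ab: "a < n" "b < n" and pos: "b + 2 < n \<or> 2 \<le> a"
    show "\<mu> X $$ (a, b) = 0"
    \<comment> \<open>For a fixed position the entry of \<open>\<mu> X\<close> is a linear
      functional of \<open>X\<close>, so matrix units suffice.\<close>
    proof (rule linear_functional_zero[of n "\<lambda>X. \<mu> X $$ (a, b)", OF _ _ _ X])
      fix Y Z assume "Y \<in> ?S" "Z \<in> ?S"
      then show "\<mu> (Y + Z) $$ (a, b) = \<mu> Y $$ (a, b) + \<mu> Z $$ (a, b)"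
        using \<mu>_carrier[of Z] ab by (simp add: \<mu>_add)
    next
      fix d Y assume "Y \<in> ?S"
      then show "\<mu> (d \<cdot>\<^sub>m Y) $$ (a, b) = d * \<mu> Y $$ (a, b)"
        using \<mu>_carrier[of Y] ab by (simp add: \<mu>_smult)
    next
      fix i j :: nat assume ij: "i < j" "j < n"
      \<comment> \<open>The two alternatives of \<open>pos\<close> are the ranges covered by
        \<open>column\<close> and by \<open>row\<close>.\<close>
      have "G i j a b = (if a = i \<and> b = j then c else 0)"
        using column[OF assms(1) ij, of b a] row[OF assms(1) ij, of a b] ab pos
        by (auto simp: c_def)
      then show "\<mu> (?E i j) $$ (a, b) = 0"
        using ab by (auto simp: \<mu>_def G_def matrix_unit_def)
    qed
  qed
  then show ?thesis using fX \<mu>_add unfolding additive_map_on_def by blast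
qed

end
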